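(* Assume that the equation $(I-A)x^s-Bu^s=E\mu_W+z$ has a solution $(x^s,u^s)\in\mathbb{R}^n\times\mathbb{R}^l$ and that $(A,Q_1^{1/2})$ is detectable. Let $(X^s_\star(\cdot),U^s_\star(\cdot))$ and $\alpha\in\mathcal{K}_\infty$ be as fixed in the context. Then for every $X_0$ there exists a constant $C\in\mathbb{R}$ such that for each $N\in\mathbb{N}$, each $\delta>0$, each control process $U(\cdot)$ satisfying $J_N(X_0,U(\cdot))\le\delta+\sum_{k=0}^{N-1}\ell(X^s_\star(k),U^s_\star(k))$ and each $\varepsilon>0$ the value $$\mathcal{L}_\varepsilon:=\#\Big\{k\in\{0,\dots,N-1\}\;\Big|\;\mathbb{E}\big[\|X_U(k,X_0)-X^s_\star(k)\|^2\big]\le\varepsilon\Big\}$$ satisfies $\mathcal{L}_\varepsilon\ge N-(\delta+C)/\alpha(\varepsilon)$.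
   Context: Setting. Let $A\in\mathbb{R}^{n\times n}$, $B\in\mathbb{R}^{n\times l}$ with $(A,B)$ stabilizable, $E\in\mathbb{R}^{n\times m}$, $z\in\mathbb{R}^n$. Let $(\Omega,\mathcal{F},\mathbb{P})$ be a probability space and $\{W(k)\}_{k\in\mathbb{N}_0}\subset L^2(\Omega,\mathcal{F},\mathbb{P};\mathbb{R}^m)$ a fixed i.i.d. sequence with common (not necessarily Gaussian) distribution $\varrho_W$, mean $\mu_W$ and covariance $\Sigma_W$. The stochastic system is $$X(k+1)=f(X(k),U(k),W(k)):=AX(k)+BU(k)+EW(k)+z,\quad X(0)=X_0,$$ where $X(k)\in L^2(\Omega,\mathcal{F}_k,\mathbb{P};\mathbb{R}^n)$, $U(k)\in L^2(\Omega,\mathcal{F}_k,\mathbb{P};\mathbb{R}^l)$, $\mathcal{F}_k=\sigma(X(0),\dots,X(k))$ is the natural filtration of the state process, and $W(k)$ is independent of $X(k)$ and $U(k)$ for every $k$. These standing assumptions apply to every state/control process considered (including stationary ones) and to every $(X(k),U(k))$ in statements quantified over such pairs. $X_U(\cdot,X_0)$ denotes the solution for initial value $X_0$ and control $U(\cdot)$. Stage cost: $$\ell(X,U):=\mathbb{E}\big[X^TQ_1X+U^TR_1U+r^TX+v^TU+c\big]+\mathrm{Tr}\big(Q_2\mathrm{Cov}(X)+R_2\mathrm{Cov}(U)\big),$$ with symmetric $Q_1,Q_2\in\mathbb{R}^{n\times n}$, $R_1,R_2\in\mathbb{R}^{l\times l}$, $Q_1,Q_2,R_2\ge 0$, $R_1>0$,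 $r\in\mathbb{R}^n$, $v\in\mathbb{R}^l$, $c\in\mathbb{R}$. For horizon $N\in\mathbb{N}$, $J_N(X_0,U):=\sum_{k=0}^{N-1}\ell(X(k),U(k))$ along the solution $X(\cdot)=X_U(\cdot,X_0)$. For $M\ge0$, $\|x\|_M:=\sqrt{x^TMx}$; $\|\cdot\|$ is the Euclidean norm. Deterministic vectors are regarded as constant random variables. $\mathcal{K}_\infty$ is the set of continuous, strictly increasing, unbounded $\alpha:[0,\infty)\to[0,\infty)$ with $\alpha(0)=0$. $\mathcal{P}_2(\mathcal{X})$ is the set of probability measures on $\mathcal{X}$ with finite second moment. Data. Under the assumptions of the claim, fix a solution $(x^s,u^s)$ and the following objects (all of which exist). $P$ is the positive semidefinite solution of $P=A^TPA+(Q_1+Q_2)-A^TPB[(R_1+R_2)+B^TPB]^{-1}B^TPA$ and $K:=-[(R_1+R_2)+B^TPB]^{-1}B^TPA$. Put $\hat W(k):=W(k)-\mu_W$, $\hat r:=r+2Q_1x^s$, $\hat v:=v+2R_1u^s$, $\hat c:=(x^s)^TQ_1x^s+(u^s)^TR_1u^s+r^Tx^s+v^Tu^s+c$ and $$\hat\ell(X,U):=\mathbb{E}[X^TQ_1X+U^TR_1U+\hat r^TX+\hat v^TU+\hat c]+\mathrm{Tr}(Q_2\mathrm{Cov}(X)+R_2\mathrm{Cov}(U)).$$ $\hat X^s(\cdot)$ is the process $\hat X^s(k+1)=A\hat X^s(k)+B\hat U^s(k)+E\hat W(k)$, $\hat U^s(k)=K\hat X^s(k)$, with $\hat X^s(k)\sim\hat\varrho_X^s\in\mathcal{P}_2(\mathbb{R}^n)$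 for all $k$ ($\hat\varrho_X^s$ an invariant distribution, with zero mean). Further, $(\tilde x^s_\star,\tilde u^s_\star)$ is a solution of $(I-A)x-Bu=0$, $\alpha\in\mathcal{K}_\infty$, $S\in\mathbb{R}^{n\times n}$ is symmetric positive definite and $q\in\mathbb{R}^n$, such that, with $\tilde X(k):=X(k)-x^s-\hat X^s(k)$, $\tilde U(k):=U(k)-u^s-\hat U^s(k)$, $\tilde X(k+1):=A\tilde X(k)+B\tilde U(k)$ and $\tilde\lambda(Y):=\mathbb{E}[\|Y\|_S^2+q^TY]$, the inequality $$\hat\ell(\tilde X(k),\tilde U(k))-\hat\ell(\tilde x^s_\star,\tilde u^s_\star)+\tilde\lambda(\tilde X(k))-\tilde\lambda(\tilde X(k+1))\ge\alpha\big(\mathbb{E}[\|\tilde X(k)-\tilde x^s_\star\|^2]\big)$$ holds for all $k\in\mathbb{N}_0$ and all $(X(k),U(k))\in L^2(\Omega,\mathcal{F}_k,\mathbb{P};\mathbb{R}^n)\times L^2(\Omega,\mathcal{F}_k,\mathbb{P};\mathbb{R}^l)$. The stationary pair $(X^s_\star(\cdot),U^s_\star(\cdot))$ is defined by $X^s_\star(0)=\hat X^s(0)+x^s+\tilde x^s_\star$, $X^s_\star(k+1)=f(X^s_\star(k),U^s_\star(k),W(k))$, $U^s_\star(k)=K(X^s_\star(k)-\tilde x^s_\star-x^s)+\tilde u^s_\star+u^s$; the law of $X^s_\star(k)$ is independent of $k$ and denoted $\varrho_X^{s,\star}\in\mathcal{P}_2(\mathbb{R}^n)$. *)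

theory Defs
  imports "HOL-Probability.Probability"
begin

definition psd :: "real^'n^'n \<Rightarrow> bool" where
  "psd Q \<longleftrightarrow> transpose Q = Q \<and> (\<forall>x. 0 \<le> x \<bullet> (Q *v x))"

definition pos_def :: "real^'n^'n \<Rightarrow> bool" where
  "pos_def Q \<longleftrightarrow> transpose Q = Q \<and> (\<forall>x. x \<noteq> 0 \<longrightarrow> 0 < x \<bullet> (Q *v x))"

definition psd_sqrt :: "real^'n^'n \<Rightarrow> real^'n^'n" where
  "psd_sqrt Q = (THE G. psd G \<and> G ** G = Q)"

definition weighted_norm :: "real^'n^'n \<Rightarrow> real^'n \<Rightarrow> real" where
  "weighted_norm S x = sqrt (x \<bullet> (S *v x))"

text \<open>Discrete-time stability: every complex eigenvalue of the real matrix lies in the open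
  unit disc.\<close>

definition complex_eigenvalue :: "real^'n^'n \<Rightarrow> complex \<Rightarrow> bool" where
  "complex_eigenvalue A l \<longleftrightarrow>
     (\<exists>x :: complex^'n. x \<noteq> 0 \<and> (\<chi> i j. complex_of_real (A $ i $ j)) *v x = l *s x)"

definition schur_stable :: "real^'n^'n \<Rightarrow> bool" where
  "schur_stable A \<longleftrightarrow> (\<forall>l. complex_eigenvalue A l \<longrightarrow> norm l < 1)"

definition stabilizable :: "real^'n^'n \<Rightarrow> real^'l^'n \<Rightarrow> bool" where
  "stabilizable A B \<longleftrightarrow> (\<exists>F :: real^'n^'l. schur_stable (A + B ** F))"

definition detectable :: "real^'n^'n \<Rightarrow> real^'n^'p \<Rightarrow> bool" where
  "detectable A C \<longleftrightarrow> (\<exists>L :: real^'p^'n. schur_stable (A + L ** C))"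

definition K_inf :: "(real \<Rightarrow> real) set" where
  "K_inf = {\<alpha>. continuous_on {0..} \<alpha> \<and> strict_mono_on {0..} \<alpha> \<and> \<alpha> 0 = 0
                \<and> (\<forall>b. \<exists>s\<ge>0. b < \<alpha> s)}"

text \<open>\<open>F\<close> is a sub-\<open>\<sigma>\<close>-algebra of \<open>M\<close>. Random variables are represented by functions and not by
  classes modulo null sets; requiring \<open>subalgebra M F\<close> matters when \<open>F\<close> is generated by the process
  itself, where \<open>F\<close>-measurability alone would be no restriction.\<close>

definition L2 :: "'w measure \<Rightarrow> 'w measure \<Rightarrow> ('w \<Rightarrow> 'b::euclidean_space) set" where
  "L2 M F = {X. subalgebra M F \<and> X \<in> borel_measurable F \<and> integrable M (\<lambda>\<omega>. (norm (X \<omega>))\<^sup>2)}"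

definition P2 :: "('b::euclidean_space) measure set" where
  "P2 = {\<rho>. prob_space \<rho> \<and> sets \<rho> = sets borel \<and> integrable \<rho> (\<lambda>x. (norm x)\<^sup>2)}"

definition cov_mat :: "'w measure \<Rightarrow> ('w \<Rightarrow> real^'n) \<Rightarrow> real^'n^'n" where
  "cov_mat M X = (\<chi> i j. integral\<^sup>L M (\<lambda>\<omega>.
      (X \<omega> $ i - integral\<^sup>L M (\<lambda>\<omega>. X \<omega> $ i)) * (X \<omega> $ j - integral\<^sup>L M (\<lambda>\<omega>. X \<omega> $ j))))"

text \<open>The library's \<open>indep_var\<close> requires both random variables to take values in the same type;
  this is its characterisation by generated \<open>\<sigma>\<close>-algebras, for two different codomains.\<close>

definition indep_rv ::
  "'w measure \<Rightarrow> ('w \<Rightarrow> 'b::topological_space) \<Rightarrow> ('w \<Rightarrow> 'c::topological_space) \<Rightarrow> bool" where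
  "indep_rv M X Y \<longleftrightarrow> prob_space.indep_set M
     (sets (vimage_algebra (space M) X borel)) (sets (vimage_algebra (space M) Y borel))"

definition nat_filtration ::
  "'w measure \<Rightarrow> (nat \<Rightarrow> 'w \<Rightarrow> 'b::topological_space) \<Rightarrow> nat \<Rightarrow> 'w measure" where
  "nat_filtration M X k =
     sigma (space M) {X i -` S \<inter> space M | i S. i \<le> k \<and> S \<in> sets borel}"

definition sys_f ::
  "real^'n^'n \<Rightarrow> real^'l^'n \<Rightarrow> real^'m^'n \<Rightarrow> real^'n \<Rightarrow> real^'n \<Rightarrow> real^'l \<Rightarrow> real^'m \<Rightarrow> real^'n" where
  "sys_f A B E z x u w = A *v x + B *v u + E *v w + z"

primrec solution ::
  "real^'n^'n \<Rightarrow> real^'l^'n \<Rightarrow> real^'m^'n \<Rightarrow> real^'n \<Rightarrow> (nat \<Rightarrow> 'w \<Rightarrow> real^'m)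
    \<Rightarrow> (nat \<Rightarrow> 'w \<Rightarrow> real^'l) \<Rightarrow> ('w \<Rightarrow> real^'n) \<Rightarrow> nat \<Rightarrow> 'w \<Rightarrow> real^'n" where
  "solution A B E z W U X0 0 = X0"
| "solution A B E z W U X0 (Suc k) =
     (\<lambda>\<omega>. sys_f A B E z (solution A B E z W U X0 k \<omega>) (U k \<omega>) (W k \<omega>))"

text \<open>Standing assumptions on a state/control process: each \<open>W k\<close> is independent of \<open>X k\<close> and
  independent of \<open>U k\<close>; joint independence of \<open>(X k, U k)\<close> is not required. The
  filtration is the one generated by the state process itself, so for \<open>X = solution A B E z W U X0\<close> it depends on the control.\<close>

definition admissible ::
  "'w measure \<Rightarrow> (nat \<Rightarrow> 'w \<Rightarrow> real^'m) \<Rightarrow> (nat \<Rightarrow> 'w \<Rightarrow> real^'n) \<Rightarrow> (nat \<Rightarrow> 'w \<Rightarrow> real^'l) \<Rightarrow> bool"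
  where
  "admissible M W X U \<longleftrightarrow> (\<forall>k.
       X k \<in> L2 M (nat_filtration M X k) \<and> U k \<in> L2 M (nat_filtration M X k)
     \<and> indep_rv M (W k) (X k) \<and> indep_rv M (W k) (U k))"

text \<open>The trace is taken separately on the state and the control part, which are square matrices of
  different sizes.\<close>

definition stage_cost ::
  "'w measure \<Rightarrow> real^'n^'n \<Rightarrow> real^'n^'n \<Rightarrow> real^'l^'l \<Rightarrow> real^'l^'l \<Rightarrow> real^'n \<Rightarrow> real^'l \<Rightarrow> real
    \<Rightarrow> ('w \<Rightarrow> real^'n) \<Rightarrow> ('w \<Rightarrow> real^'l) \<Rightarrow> real" where
  "stage_cost M Q1 Q2 R1 R2 r v c X U =
     integral\<^sup>L M (\<lambda>\<omega>. X \<omega> \<bullet> (Q1 *v X \<omega>) + U \<omega> \<bullet> (R1 *v U \<omega>) + r \<bullet> X \<omega> + v \<bullet> U \<omega> + c)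
     + (trace (Q2 ** cov_mat M X) + trace (R2 ** cov_mat M U))"

definition total_cost ::
  "'w measure \<Rightarrow> real^'n^'n \<Rightarrow> real^'l^'n \<Rightarrow> real^'m^'n \<Rightarrow> real^'n \<Rightarrow> (nat \<Rightarrow> 'w \<Rightarrow> real^'m)
    \<Rightarrow> real^'n^'n \<Rightarrow> real^'n^'n \<Rightarrow> real^'l^'l \<Rightarrow> real^'l^'l \<Rightarrow> real^'n \<Rightarrow> real^'l \<Rightarrow> real
    \<Rightarrow> nat \<Rightarrow> ('w \<Rightarrow> real^'n) \<Rightarrow> (nat \<Rightarrow> 'w \<Rightarrow> real^'l) \<Rightarrow> real" where
  "total_cost M A B E z W Q1 Q2 R1 R2 r v c N X0 U =
     (\<Sum>k<N. stage_cost M Q1 Q2 R1 R2 r v c (solution A B E z W U X0 k) (U k))"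

definition storage :: "'w measure \<Rightarrow> real^'n^'n \<Rightarrow> real^'n \<Rightarrow> ('w \<Rightarrow> real^'n) \<Rightarrow> real" where
  "storage M S q Y = integral\<^sup>L M (\<lambda>\<omega>. (weighted_norm S (Y \<omega>))\<^sup>2 + q \<bullet> Y \<omega>)"

end

theory Submission
  imports Defs
begin

text \<open>
  Write any admissible pair as \<open>X = x\<^sup>s + Xhat + Y\<close>, \<open>U = u\<^sup>s + Uhat + V\<close>. The noise
  cancels from the deviation, so \<open>Y\<close> obeys the undisturbed recursion
  \<open>Y(k+1) = A Y(k) + B V(k)\<close>. Since \<open>Xhat\<close> and \<open>Uhat\<close> have mean zero, the quadratic stage cost
  splits (\<open>stage_cost_decompose\<close>) into the shifted cost of \<open>(Y, V)\<close>, the cost of the stationary part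
  alone, and the cross term
  \<open>2 E[Y \<bullet> (Q1 + Q2) Xhat + V \<bullet> (R1 + R2) Uhat]\<close>.

  The cross term does not vanish in general, but it telescopes. Because \<open>Uhat = K Xhat\<close> with \<open>K\<close> the
  Riccati gain, the integrand equals
  \<open>Y \<bullet> P Xhat - (A Y + B V) \<bullet> P (A Xhat + B Uhat)\<close> pointwise (\<open>riccati_cross_term\<close>), and the new noise in
  \<open>Xhat(k+1)\<close> has mean zero and is uncorrelated with \<open>Y(k+1)\<close> (\<open>expectation_inner_next_noise\<close>). With
  \<open>Z(k) = E[Y(k) \<bullet> P Xhat(k)]\<close> the cross term is therefore \<open>2 (Z(k) - Z(k+1))\<close>. For the
  stationary pair \<open>(Xstar, Ustar)\<close> the deviation is the constant \<open>(xt, ut)\<close> and the cross term is zero.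

  Subtracting the two costs removes the stationary part, and the dissipation inequality holds for the
  true cost difference once the storage \<open>\<lambda>(Y) = E[Y \<bullet> S Y + q \<bullet> Y]\<close> is replaced by
  \<open>\<Phi>(k) = \<lambda>(Y(k)) - 2 Z(k)\<close>. Summation leaves \<open>\<Phi>(0) - \<Phi>(N)\<close>. The first term depends
  on the initial value only. The second is bounded because \<open>\<Phi>(N)\<close> is a positive definite
  quadratic in \<open>Y(N)\<close> plus a linear term whose random coefficient has a law independent of \<open>N\<close>
  (\<open>storage_dominates_linear\<close>). Hence the sum of \<open>\<alpha>(E \<bar>Y(k) - xt\<bar>\<^sup>2)\<close> is at most
  \<open>\<delta> + C\<close>. Since \<open>Y - xt = X - Xstar\<close>, counting the times at which a summand exceeds
  \<open>\<alpha>(\<epsilon>)\<close> gives the estimate (\<open>count_from_sum_bound\<close>).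
\<close>

section \<open>Square-integrable random vectors\<close>

lemma L2_D:
  assumes "X \<in> L2 M F"
  shows "X \<in> borel_measurable M" "integrable M (\<lambda>\<omega>. (norm (X \<omega>))\<^sup>2)"
  using assms measurable_from_subalg unfolding L2_def by blast+

lemma L2_top_I:
  assumes "X \<in> borel_measurable M" "integrable M (\<lambda>\<omega>. (norm (X \<omega>))\<^sup>2)"
  shows "X \<in> L2 M M"
  using assms by (auto simp: L2_def subalgebra_def)

lemma L2_top: "X \<in> L2 M F \<Longrightarrow> X \<in> L2 M M"
  by (intro L2_top_I L2_D)

lemma L2_inner_integrable:
  assumes "X \<in> L2 M M" "Y \<in> L2 M M"
  shows "integrable M (\<lambda>\<omega>. X \<omega> \<bullet> Y \<omega>)"
proof (rule Bochner_Integration.integrable_bound)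
  show "integrable M (\<lambda>\<omega>. (norm (X \<omega>))\<^sup>2 + (norm (Y \<omega>))\<^sup>2)"
    using L2_D[OF assms(1)] L2_D[OF assms(2)] by simp
  show "(\<lambda>\<omega>. X \<omega> \<bullet> Y \<omega>) \<in> borel_measurable M"
    using L2_D[OF assms(1)] L2_D[OF assms(2)] by simp
  have "\<bar>x \<bullet> y\<bar> \<le> (norm x)\<^sup>2 + (norm y)\<^sup>2" for x y :: 'b
  proof -
    have "\<bar>x \<bullet> y\<bar> \<le> norm x * norm y" by (rule Cauchy_Schwarz_ineq2)
    also have "\<dots> \<le> (norm x)\<^sup>2 + (norm y)\<^sup>2"
      using sum_squares_bound[of "norm x" "norm y"] mult_nonneg_nonneg[of "norm x" "norm y"]
      unfolding mult.assoc by (smt (verit) norm_ge_zero)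
    finally show ?thesis .
  qed
  then show "AE \<omega> in M. norm (X \<omega> \<bullet> Y \<omega>) \<le> norm ((norm (X \<omega>))\<^sup>2 + (norm (Y \<omega>))\<^sup>2)"
    by simp
qed

lemma L2_add:
  assumes "X \<in> L2 M M" "Y \<in> L2 M M"
  shows "(\<lambda>\<omega>. X \<omega> + Y \<omega>) \<in> L2 M M"
proof (rule L2_top_I)
  show "(\<lambda>\<omega>. X \<omega> + Y \<omega>) \<in> borel_measurable M"
    using L2_D[OF assms(1)] L2_D[OF assms(2)] by simp
  show "integrable M (\<lambda>\<omega>. (norm (X \<omega> + Y \<omega>))\<^sup>2)"
    using L2_inner_integrable[OF assms(1) assms(1)] L2_inner_integrable[OF assms(2) assms(2)]
      L2_inner_integrable[OF assms(1) assms(2)] L2_inner_integrable[OF assms(2) assms(1)]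
    by (simp add: power2_norm_eq_inner inner_add_left inner_add_right)
qed

lemma L2_matrix:
  fixes G :: "real^'n^'m"
  assumes "X \<in> L2 M M"
  shows "(\<lambda>\<omega>. G *v X \<omega>) \<in> L2 M M"
proof (rule L2_top_I)
  show meas: "(\<lambda>\<omega>. G *v X \<omega>) \<in> borel_measurable M"
    by (rule measurable_compose[OF L2_D(1)[OF assms]])
      (simp add: borel_measurable_continuous_onI linear_continuous_on)
  show "integrable M (\<lambda>\<omega>. (norm (G *v X \<omega>))\<^sup>2)"
  proof (rule Bochner_Integration.integrable_bound)
    show "integrable M (\<lambda>\<omega>. (onorm ((*v) G))\<^sup>2 * (norm (X \<omega>))\<^sup>2)"
      using L2_D[OF assms] by simp
    show "(\<lambda>\<omega>. (norm (G *v X \<omega>))\<^sup>2) \<in> borel_measurable M" using meas by simp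
    have "(norm (G *v x))\<^sup>2 \<le> (onorm ((*v) G))\<^sup>2 * (norm x)\<^sup>2" for x
      using power_mono[OF onorm[of "(*v) G" x], of 2] by (simp add: power_mult_distrib)
    then show "AE \<omega> in M. norm ((norm (G *v X \<omega>))\<^sup>2) \<le> norm ((onorm ((*v) G))\<^sup>2 * (norm (X \<omega>))\<^sup>2)"
      by simp
  qed
qed

lemma L2_diff:
  assumes "X \<in> L2 M M" "Y \<in> L2 M M"
  shows "(\<lambda>\<omega>. X \<omega> - Y \<omega>) \<in> L2 M M"
proof -
  have "(\<lambda>\<omega>. - Y \<omega>) \<in> L2 M M"
    using L2_D[OF assms(2)] by (intro L2_top_I) simp_all
  from L2_add[OF assms(1) this] show ?thesis by simp
qed

lemma expectation_matrix:
  fixes G :: "real^'n^'m"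
  assumes "integrable M X"
  shows "integral\<^sup>L M (\<lambda>\<omega>. G *v X \<omega>) = G *v integral\<^sup>L M X"
  by (rule integral_bounded_linear[OF matrix_vector_mul_bounded_linear assms])

lemma dot_matrix_transpose:
  fixes G :: "real^'n^'m"
  shows "x \<bullet> (G *v y) = (transpose G *v x) \<bullet> y"
  by (metis dot_lmul_matrix transpose_matrix_vector)

lemma dot_matrix_symmetric:
  fixes Q :: "real^'n^'n"
  assumes "transpose Q = Q"
  shows "x \<bullet> (Q *v y) = y \<bullet> (Q *v x)"
  using dot_matrix_transpose[of x Q y] assms by (simp add: inner_commute)

context prob_space
begin

lemma L2_const: "(\<lambda>_. a) \<in> L2 M M"
  by (intro L2_top_I) simp_all

lemma L2_integrable:
  assumes "X \<in> L2 M M"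
  shows "integrable M X"
proof (rule Bochner_Integration.integrable_bound)
  show "integrable M (\<lambda>\<omega>. 1 + (norm (X \<omega>))\<^sup>2)" using L2_D[OF assms] by simp
  show "X \<in> borel_measurable M" using L2_D[OF assms] by simp
  have "norm x \<le> 1 + (norm x)\<^sup>2" for x :: 'b
    using sum_squares_bound[of "norm x" 1] norm_ge_zero[of x]
    unfolding mult_1_right power_one by linarith
  then show "AE \<omega> in M. norm (X \<omega>) \<le> norm (1 + (norm (X \<omega>))\<^sup>2)" by simp
qed

section \<open>Independence and second moments\<close>

lemma indep_rv_compose:
  fixes X :: "'a \<Rightarrow> 'b::topological_space" and Y :: "'a \<Rightarrow> 'c::topological_space"
    and f :: "'b \<Rightarrow> 'd::topological_space" and g :: "'c \<Rightarrow> 'e::topological_space"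
  assumes ind: "indep_rv M X Y" and f: "f \<in> borel_measurable borel" and g: "g \<in> borel_measurable borel"
  shows "indep_rv M (\<lambda>\<omega>. f (X \<omega>)) (\<lambda>\<omega>. g (Y \<omega>))"
proof -
  have mono: "sets (vimage_algebra (space M) (\<lambda>\<omega>. h (Z \<omega>)) borel) \<subseteq> sets (vimage_algebra (space M) Z borel)"
    if "h \<in> borel_measurable borel"
    for h :: "'x::topological_space \<Rightarrow> 'y::topological_space" and Z :: "'a \<Rightarrow> 'x"
  proof -
    have "Z \<in> measurable (vimage_algebra (space M) Z borel) borel"
      by (intro measurable_vimage_algebra1) simp
    then have "(\<lambda>\<omega>. h (Z \<omega>)) \<in> measurable (vimage_algebra (space M) Z borel) borel"
      using that by (rule measurable_compose)
    then show ?thesis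
      by (metis measurable_iff_sets space_vimage_algebra)
  qed
  show ?thesis
    using ind mono[OF f, of X] mono[OF g, of Y] unfolding indep_rv_def indep_sets2_eq by blast
qed

lemma indep_rv_imp_indep_var:
  assumes "indep_rv M X Y" "X \<in> borel_measurable M" "Y \<in> borel_measurable M"
  shows "indep_var borel X borel Y"
  using assms unfolding indep_rv_def indep_var_eq sets_vimage_algebra by simp

lemma expectation_inner_indep:
  fixes X Y :: "'a \<Rightarrow> 'b::euclidean_space"
  assumes ind: "indep_rv M X Y" and X: "integrable M X" and Y: "integrable M Y"
  shows "expectation (\<lambda>\<omega>. Y \<omega> \<bullet> X \<omega>) = expectation Y \<bullet> expectation X"
proof -
  have b: "integrable M (\<lambda>\<omega>. (X \<omega> \<bullet> b) * (Y \<omega> \<bullet> b))"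
    "expectation (\<lambda>\<omega>. (X \<omega> \<bullet> b) * (Y \<omega> \<bullet> b)) = (expectation X \<bullet> b) * (expectation Y \<bullet> b)" for b
  proof -
    have iv: "indep_var borel (\<lambda>\<omega>. X \<omega> \<bullet> b) borel (\<lambda>\<omega>. Y \<omega> \<bullet> b)"
      using X Y by (intro indep_rv_imp_indep_var indep_rv_compose[OF ind]) auto
    show "integrable M (\<lambda>\<omega>. (X \<omega> \<bullet> b) * (Y \<omega> \<bullet> b))"
      by (rule indep_var_integrable[OF iv]) (use X Y in auto)
    show "expectation (\<lambda>\<omega>. (X \<omega> \<bullet> b) * (Y \<omega> \<bullet> b)) = (expectation X \<bullet> b) * (expectation Y \<bullet> b)"
      using indep_var_lebesgue_integral[OF iv] X Y by simp
  qed
  have "expectation (\<lambda>\<omega>. Y \<omega> \<bullet> X \<omega>) = expectation (\<lambda>\<omega>. \<Sum>b\<in>Basis. (X \<omega> \<bullet> b) * (Y \<omega> \<bullet> b))"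
    by (subst euclidean_inner) (simp only: mult.commute)
  also have "\<dots> = (\<Sum>b\<in>Basis. (expectation X \<bullet> b) * (expectation Y \<bullet> b))"
    using b by (simp add: Bochner_Integration.integral_sum)
  also have "\<dots> = expectation Y \<bullet> expectation X"
    by (subst euclidean_inner) (simp only: mult.commute)
  finally show ?thesis .
qed

lemma expectation_inner_matrix_indep:
  fixes W :: "'a \<Rightarrow> real^'m" and Y :: "'a \<Rightarrow> real^'n" and H :: "real^'n^'p"
    and L :: "real^'m^'p"
  assumes ind: "indep_rv M W Y" and W: "W \<in> L2 M M" and Y: "Y \<in> L2 M M"
  shows "expectation (\<lambda>\<omega>. (H *v Y \<omega>) \<bullet> (L *v (W \<omega> - expectation W))) = 0"
proof -
  have m: "(\<lambda>x. J *v x) \<in> borel_measurable borel" for J :: "real^'x^'y"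
    by (simp add: borel_measurable_continuous_onI linear_continuous_on)
  have "indep_rv M (\<lambda>\<omega>. L *v (W \<omega> - expectation W)) (\<lambda>\<omega>. H *v Y \<omega>)"
    by (rule indep_rv_compose[OF ind, of "\<lambda>w. L *v (w - expectation W)" "(*v) H"])
      (auto intro: m measurable_compose[OF _ m])
  moreover have W': "(\<lambda>\<omega>. W \<omega> - expectation W) \<in> L2 M M"
    by (intro L2_diff W L2_const)
  moreover have "expectation (\<lambda>\<omega>. L *v (W \<omega> - expectation W)) = 0"
    using expectation_matrix[OF L2_integrable[OF W']] L2_integrable[OF W] by (simp add: prob_space)
  ultimately show ?thesis
    using expectation_inner_indep[of "\<lambda>\<omega>. L *v (W \<omega> - expectation W)" "\<lambda>\<omega>. H *v Y \<omega>"]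
      L2_integrable[OF L2_matrix[OF Y, of H]] L2_integrable[OF L2_matrix[OF W', of L]] by simp
qed

text \<open>The inner product is additive in its first argument and the centred noise has mean zero, so the
  expectation splits into products of means, one for each vector from which \<open>W\<close> is independent.\<close>

lemma expectation_inner_next_noise:
  fixes W :: "'a \<Rightarrow> real^'m" and X H :: "'a \<Rightarrow> real^'n" and U G :: "'a \<Rightarrow> real^'l"
    and A :: "real^'n^'n" and B :: "real^'l^'n" and L :: "real^'m^'n"
  assumes L2: "W \<in> L2 M M" "X \<in> L2 M M" "H \<in> L2 M M" "U \<in> L2 M M" "G \<in> L2 M M"
    and ind: "indep_rv M W X" "indep_rv M W H" "indep_rv M W U" "indep_rv M W G"
  shows "expectation (\<lambda>\<omega>. (A *v (X \<omega> - a - H \<omega>) + B *v (U \<omega> - b - G \<omega>)) \<bullet> (L *v (W \<omega> - expectation W))) = 0"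
proof -
  let ?w = "\<lambda>\<omega>. L *v (W \<omega> - expectation W)"
  have w: "?w \<in> L2 M M" by (intro L2_matrix L2_diff L2 L2_const)
  have zero: "expectation ?w = 0"
    using expectation_matrix[OF L2_integrable[OF L2_diff[OF L2(1) L2_const]], of L] L2_integrable[OF L2(1)]
    by (simp add: prob_space)
  have "(A *v (X \<omega> - a - H \<omega>) + B *v (U \<omega> - b - G \<omega>)) \<bullet> ?w \<omega> =
      ((A *v X \<omega>) \<bullet> ?w \<omega> - (A *v H \<omega>) \<bullet> ?w \<omega> + (B *v U \<omega>) \<bullet> ?w \<omega> - (B *v G \<omega>) \<bullet> ?w \<omega>)
      - (A *v a + B *v b) \<bullet> ?w \<omega>" for \<omega>
    by (simp only: matrix_vector_mult_diff_distrib inner_add_left inner_diff_left)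
  then show ?thesis
    using expectation_inner_matrix_indep[OF ind(1) L2(1,2), of A L]
      expectation_inner_matrix_indep[OF ind(2) L2(1,3), of A L]
      expectation_inner_matrix_indep[OF ind(3) L2(1,4), of B L]
      expectation_inner_matrix_indep[OF ind(4) L2(1,5), of B L]
      L2_inner_integrable[OF L2_matrix[OF L2(2), of A] w] L2_inner_integrable[OF L2_matrix[OF L2(3), of A] w]
      L2_inner_integrable[OF L2_matrix[OF L2(4), of B] w] L2_inner_integrable[OF L2_matrix[OF L2(5), of B] w]
      L2_integrable[OF w] zero
    by simp
qed

section \<open>The cost as a quadratic functional\<close>

text \<open>The covariance penalty is the expectation of a quadratic form in the centred vector; this puts it on
  the same footing as the other quadratic terms of the cost.\<close>

lemma trace_cov_mat:
  fixes X :: "'a \<Rightarrow> real^'n"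
  assumes X: "X \<in> L2 M M"
  shows "trace (Q ** cov_mat M X)
    = expectation (\<lambda>\<omega>. (X \<omega> - expectation X) \<bullet> (Q *v (X \<omega> - expectation X)))"
proof -
  define Y where "Y \<omega> = X \<omega> - expectation X" for \<omega>
  have Y: "Y \<in> L2 M M"
    unfolding Y_def by (intro L2_diff X L2_const)
  have comp: "expectation (\<lambda>\<omega>. X \<omega> $ i) = expectation X $ i" for i
    using integral_inner_left[of "axis i 1" M X] L2_integrable[OF X]
    by (simp add: inner_axis)
  have int: "integrable M (\<lambda>\<omega>. Y \<omega> $ i * Y \<omega> $ j)" for i j
  proof -
    have "(\<lambda>\<omega>. (\<chi> k. if k = i then Y \<omega> $ j else 0) :: real^'n) =
        (\<lambda>\<omega>. (\<chi> k l. if k = i \<and> l = j then 1 else 0) *v Y \<omega>)"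
      by (auto simp: matrix_vector_mult_def vec_eq_iff fun_eq_iff if_distrib if_distribR cong: if_cong)
    then have "(\<lambda>\<omega>. (\<chi> k. if k = i then Y \<omega> $ j else 0) :: real^'n) \<in> L2 M M"
      using L2_matrix[OF Y] by simp
    from L2_inner_integrable[OF Y this] show ?thesis
      by (simp add: inner_vec_def if_distrib cong: if_cong)
  qed
  have "trace (Q ** cov_mat M X) = (\<Sum>i\<in>UNIV. \<Sum>j\<in>UNIV. Q $ i $ j * expectation (\<lambda>\<omega>. Y \<omega> $ j * Y \<omega> $ i))"
    by (simp add: trace_def matrix_matrix_mult_def cov_mat_def Y_def comp)
  also have "\<dots> = expectation (\<lambda>\<omega>. \<Sum>i\<in>UNIV. \<Sum>j\<in>UNIV. Q $ i $ j * (Y \<omega> $ j * Y \<omega> $ i))"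
    using int by (simp add: Bochner_Integration.integral_sum)
  also have "\<dots> = expectation (\<lambda>\<omega>. Y \<omega> \<bullet> (Q *v Y \<omega>))"
    by (simp add: inner_vec_def matrix_vector_mult_def sum_distrib_left mult_ac)
  finally show ?thesis by (simp add: Y_def)
qed

definition quad_cost :: "real^'n^'n \<Rightarrow> real^'n^'n \<Rightarrow> real^'n \<Rightarrow> ('a \<Rightarrow> real^'n) \<Rightarrow> real" where
  "quad_cost Q Q' r X = expectation (\<lambda>\<omega>. X \<omega> \<bullet> (Q *v X \<omega>) + r \<bullet> X \<omega>) + trace (Q' ** cov_mat M X)"

text \<open>State and control enter the cost additively and in the same way, so the expansion below is
  carried out once, for a vector of arbitrary dimension.\<close>

lemma stage_cost_split:
  fixes X :: "'a \<Rightarrow> real^'n" and U :: "'a \<Rightarrow> real^'l"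
  assumes X: "X \<in> L2 M M" and U: "U \<in> L2 M M"
  shows "stage_cost M Q1 Q2 R1 R2 r v c X U = quad_cost Q1 Q2 r X + quad_cost R1 R2 v U + c"
  using L2_inner_integrable[OF X L2_matrix[OF X]] L2_inner_integrable[OF U L2_matrix[OF U]]
    L2_integrable[OF X] L2_integrable[OF U]
  unfolding stage_cost_def quad_cost_def by (simp add: prob_space)

text \<open>A constant shift does not change the covariance, so \<open>a\<close> only alters the linear and constant
  part. A summand of mean zero contributes no linear term, and both penalties act on its
  products with \<open>Y\<close> in the same way, because centring \<open>Y\<close> does not change its covariance with
  \<open>H\<close>; hence the weight \<open>Q + Q'\<close>.\<close>

lemma quad_cost_decompose:
  fixes Y H :: "'a \<Rightarrow> real^'n"
  assumes Y: "Y \<in> L2 M M" and H: "H \<in> L2 M M" and H0: "expectation H = 0"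
    and Q: "transpose Q = Q" and Q': "transpose Q' = Q'"
  shows "quad_cost Q Q' r (\<lambda>\<omega>. Y \<omega> + a + H \<omega>) =
    quad_cost Q Q' (r + 2 *\<^sub>R (Q *v a)) Y + (a \<bullet> (Q *v a) + r \<bullet> a)
    + expectation (\<lambda>\<omega>. H \<omega> \<bullet> ((Q + Q') *v H \<omega>)) + 2 * expectation (\<lambda>\<omega>. Y \<omega> \<bullet> ((Q + Q') *v H \<omega>))"
proof -
  define r' where "r' = r + 2 *\<^sub>R (Q *v a)"
  note iQ = L2_inner_integrable[OF _ L2_matrix]
  have X: "(\<lambda>\<omega>. Y \<omega> + a + H \<omega>) \<in> L2 M M"
    by (intro L2_add Y H L2_const)
  have iY: "integrable M Y" and iH: "integrable M H"
    using Y H by (auto intro: L2_integrable)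
  have EX: "expectation (\<lambda>\<omega>. Y \<omega> + a + H \<omega>) = expectation Y + a"
    using iY iH H0 by (simp add: prob_space)
  define V where "V \<omega> = Y \<omega> - expectation Y" for \<omega>
  have V: "V \<in> L2 M M" unfolding V_def by (intro L2_diff Y L2_const)
  have "(Y \<omega> + a + H \<omega>) \<bullet> (Q *v (Y \<omega> + a + H \<omega>)) + r \<bullet> (Y \<omega> + a + H \<omega>)
      = (Y \<omega> \<bullet> (Q *v Y \<omega>) + r' \<bullet> Y \<omega>) + (a \<bullet> (Q *v a) + r \<bullet> a) + H \<omega> \<bullet> (Q *v H \<omega>)
        + 2 * (Y \<omega> \<bullet> (Q *v H \<omega>)) + r' \<bullet> H \<omega>" for \<omega>
    using dot_matrix_symmetric[OF Q, of a "Y \<omega>"] dot_matrix_symmetric[OF Q, of a "H \<omega>"]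
      dot_matrix_symmetric[OF Q, of "Y \<omega>" "H \<omega>"]
    by (simp add: r'_def matrix_vector_right_distrib inner_add_left inner_add_right
        inner_commute[of "Q *v a"])
  then have 1: "expectation (\<lambda>\<omega>. (Y \<omega> + a + H \<omega>) \<bullet> (Q *v (Y \<omega> + a + H \<omega>)) + r \<bullet> (Y \<omega> + a + H \<omega>))
      = expectation (\<lambda>\<omega>. Y \<omega> \<bullet> (Q *v Y \<omega>) + r' \<bullet> Y \<omega>) + (a \<bullet> (Q *v a) + r \<bullet> a)
        + expectation (\<lambda>\<omega>. H \<omega> \<bullet> (Q *v H \<omega>)) + 2 * expectation (\<lambda>\<omega>. Y \<omega> \<bullet> (Q *v H \<omega>))"
    using iQ[OF Y Y, of Q] iQ[OF H H, of Q] iQ[OF Y H, of Q] iY iH H0 by (simp add: prob_space)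
  have "(V \<omega> + H \<omega>) \<bullet> (Q' *v (V \<omega> + H \<omega>))
      = V \<omega> \<bullet> (Q' *v V \<omega>) + H \<omega> \<bullet> (Q' *v H \<omega>)
        + 2 * (Y \<omega> \<bullet> (Q' *v H \<omega>)) - 2 * (expectation Y \<bullet> (Q' *v H \<omega>))" for \<omega>
    using dot_matrix_symmetric[OF Q', of "V \<omega>" "H \<omega>"]
    by (simp add: matrix_vector_right_distrib inner_add_left inner_add_right)
      (simp add: V_def inner_diff_left)
  moreover have "Y \<omega> + a + H \<omega> - expectation (\<lambda>\<omega>. Y \<omega> + a + H \<omega>) = V \<omega> + H \<omega>" for \<omega>
    by (simp add: EX V_def)
  moreover have "expectation (\<lambda>\<omega>. Q' *v H \<omega>) = 0"
    using expectation_matrix[OF iH] H0 by simp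
  ultimately have "expectation (\<lambda>\<omega>. (Y \<omega> + a + H \<omega> - expectation (\<lambda>\<omega>. Y \<omega> + a + H \<omega>)) \<bullet>
        (Q' *v (Y \<omega> + a + H \<omega> - expectation (\<lambda>\<omega>. Y \<omega> + a + H \<omega>))))
      = expectation (\<lambda>\<omega>. V \<omega> \<bullet> (Q' *v V \<omega>)) + expectation (\<lambda>\<omega>. H \<omega> \<bullet> (Q' *v H \<omega>))
        + 2 * expectation (\<lambda>\<omega>. Y \<omega> \<bullet> (Q' *v H \<omega>))"
    using iQ[OF V V, of Q'] iQ[OF H H, of Q'] iQ[OF Y H, of Q'] L2_integrable[OF L2_matrix[OF H], of Q']
    by (simp only:) simp
  then have 2: "trace (Q' ** cov_mat M (\<lambda>\<omega>. Y \<omega> + a + H \<omega>)) = trace (Q' ** cov_mat M Y)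
      + expectation (\<lambda>\<omega>. H \<omega> \<bullet> (Q' *v H \<omega>)) + 2 * expectation (\<lambda>\<omega>. Y \<omega> \<bullet> (Q' *v H \<omega>))"
    by (simp only: trace_cov_mat[OF X] trace_cov_mat[OF Y] V_def)
  show ?thesis
    using 1 2 iQ[OF H H, of Q] iQ[OF H H, of Q'] iQ[OF Y H, of Q] iQ[OF Y H, of Q']
    unfolding quad_cost_def r'_def[symmetric]
    by (simp add: matrix_vector_mult_add_rdistrib inner_add_right)
qed

lemma stage_cost_decompose:
  fixes Y H :: "'a \<Rightarrow> real^'n" and V G :: "'a \<Rightarrow> real^'l"
  assumes L2: "Y \<in> L2 M M" "H \<in> L2 M M" "V \<in> L2 M M" "G \<in> L2 M M"
    and mean: "expectation H = 0" "expectation G = 0"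
    and sym: "transpose Q1 = Q1" "transpose Q2 = Q2" "transpose R1 = R1" "transpose R2 = R2"
  shows "stage_cost M Q1 Q2 R1 R2 r v c (\<lambda>\<omega>. Y \<omega> + a + H \<omega>) (\<lambda>\<omega>. V \<omega> + b + G \<omega>) =
    stage_cost M Q1 Q2 R1 R2 (r + 2 *\<^sub>R (Q1 *v a)) (v + 2 *\<^sub>R (R1 *v b))
      (a \<bullet> (Q1 *v a) + b \<bullet> (R1 *v b) + r \<bullet> a + v \<bullet> b + c) Y V
    + (expectation (\<lambda>\<omega>. H \<omega> \<bullet> ((Q1 + Q2) *v H \<omega>)) + expectation (\<lambda>\<omega>. G \<omega> \<bullet> ((R1 + R2) *v G \<omega>)))
    + 2 * (expectation (\<lambda>\<omega>. Y \<omega> \<bullet> ((Q1 + Q2) *v H \<omega>)) + expectation (\<lambda>\<omega>. V \<omega> \<bullet> ((R1 + R2) *v G \<omega>)))"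
proof -
  have "(\<lambda>\<omega>. Y \<omega> + a + H \<omega>) \<in> L2 M M" "(\<lambda>\<omega>. V \<omega> + b + G \<omega>) \<in> L2 M M"
    by (intro L2_add L2_const L2)+
  then show ?thesis
    by (simp add: stage_cost_split L2 quad_cost_decompose mean sym)
qed

text \<open>This is what keeps the boundary term at the end of the horizon under control. The bound does not
  involve \<open>Y\<close>, and it depends on \<open>H\<close> only through its law.\<close>

lemma storage_dominates_linear:
  fixes Y H :: "'a \<Rightarrow> real^'n"
  assumes Y: "Y \<in> L2 M M" and H: "H \<in> L2 M M"
    and \<sigma>: "\<sigma> > 0" "\<And>x. \<sigma> * (norm x)\<^sup>2 \<le> x \<bullet> (S *v x)"
  shows "2 * expectation (\<lambda>\<omega>. Y \<omega> \<bullet> (P *v H \<omega>)) - storage M S q Y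
    \<le> expectation (\<lambda>\<omega>. (norm (q - (2 *\<^sub>R P) *v H \<omega>))\<^sup>2 / (4 * \<sigma>))"
proof -
  have pointwise: "2 * (y \<bullet> (P *v h)) - (y \<bullet> (S *v y) + q \<bullet> y) \<le> (norm (q - (2 *\<^sub>R P) *v h))\<^sup>2 / (4 * \<sigma>)"
    for y h
  proof -
    define d where "d = q - (2 *\<^sub>R P) *v h"
    \<comment> \<open>Completing the square in \<open>y\<close>.\<close>
    have "0 \<le> (norm ((2 * \<sigma>) *\<^sub>R y + d))\<^sup>2" by simp
    also have "\<dots> = (4 * \<sigma>) * (\<sigma> * (norm y)\<^sup>2 + d \<bullet> y) + (norm d)\<^sup>2"
      by (simp add: power2_norm_eq_inner inner_add_left inner_add_right inner_commute[of y d] algebra_simps)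
    finally have "- (\<sigma> * (norm y)\<^sup>2 + d \<bullet> y) \<le> (norm d)\<^sup>2 / (4 * \<sigma>)"
      using \<sigma>(1) by (simp add: field_simps)
    moreover have "d \<bullet> y = q \<bullet> y - 2 * (y \<bullet> (P *v h))"
      by (simp add: d_def inner_diff_left scaleR_matrix_vector_assoc[symmetric] inner_commute[of y])
    ultimately show ?thesis using \<sigma>(2)[of y] by (simp add: d_def)
  qed
  have "0 \<le> x \<bullet> (S *v x)" for x
    using \<sigma>(1) \<sigma>(2)[of x] by (meson less_imp_le mult_nonneg_nonneg order_trans zero_le_power2)
  then have st: "storage M S q Y = expectation (\<lambda>\<omega>. Y \<omega> \<bullet> (S *v Y \<omega>) + q \<bullet> Y \<omega>)"
    by (simp add: storage_def weighted_norm_def)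
  have i: "integrable M (\<lambda>\<omega>. Y \<omega> \<bullet> (P *v H \<omega>))" "integrable M (\<lambda>\<omega>. Y \<omega> \<bullet> (S *v Y \<omega>) + q \<bullet> Y \<omega>)"
    using L2_inner_integrable[OF Y L2_matrix[OF H, of P]] L2_inner_integrable[OF Y L2_matrix[OF Y, of S]]
      L2_integrable[OF Y] by auto
  have "2 * expectation (\<lambda>\<omega>. Y \<omega> \<bullet> (P *v H \<omega>)) - storage M S q Y
    = expectation (\<lambda>\<omega>. 2 * (Y \<omega> \<bullet> (P *v H \<omega>)) - (Y \<omega> \<bullet> (S *v Y \<omega>) + q \<bullet> Y \<omega>))"
    unfolding st using i by simp
  also have "\<dots> \<le> expectation (\<lambda>\<omega>. (norm (q - (2 *\<^sub>R P) *v H \<omega>))\<^sup>2 / (4 * \<sigma>))"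
  proof (rule integral_mono[OF _ _ pointwise])
    show "integrable M (\<lambda>\<omega>. 2 * (Y \<omega> \<bullet> (P *v H \<omega>)) - (Y \<omega> \<bullet> (S *v Y \<omega>) + q \<bullet> Y \<omega>))"
      using i by simp
    show "integrable M (\<lambda>\<omega>. (norm (q - (2 *\<^sub>R P) *v H \<omega>))\<^sup>2 / (4 * \<sigma>))"
      by (intro integrable_divide L2_D(2)[OF L2_diff] L2_const L2_matrix H)
  qed
  finally show ?thesis .
qed

end

section \<open>Positive definite matrices and the Riccati equation\<close>

text \<open>The minimum of the quadratic form over the unit sphere is attained, hence positive.\<close>

lemma pos_def_coercive:
  fixes S :: "real^'n^'n"
  assumes "pos_def S"
  obtains \<sigma> where "\<sigma> > 0" "\<And>x. \<sigma> * (norm x)\<^sup>2 \<le> x \<bullet> (S *v x)"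
proof -
  let ?f = "\<lambda>x. x \<bullet> (S *v x)"
  have "continuous_on (sphere 0 1) ?f"
    by (intro continuous_intros linear_continuous_on) auto
  moreover have "sphere (0::real^'n) 1 \<noteq> {}" by simp
  ultimately obtain u where u: "u \<in> sphere 0 1" "\<And>x. x \<in> sphere 0 1 \<Longrightarrow> ?f u \<le> ?f x"
    using continuous_attains_inf[OF compact_sphere, of 0 1 ?f] by blast
  show thesis
  proof (rule that)
    have "u \<noteq> 0" using u(1) by auto
    then show "?f u > 0" using assms unfolding pos_def_def by blast
    show "?f u * (norm x)\<^sup>2 \<le> ?f x" for x
    proof (cases "x = 0")
      case False
      then have "?f u \<le> ?f (x /\<^sub>R norm x)" by (intro u(2)) simp
      also have "\<dots> = ?f x / (norm x)\<^sup>2"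
        by (simp add: linear_scale[OF matrix_vector_mul_linear] power2_eq_square divide_inverse)
      finally show ?thesis using False by (simp add: field_simps)
    qed simp
  qed
qed

lemma pos_def_matrix_inv:
  fixes G :: "real^'n^'n"
  assumes "pos_def G"
  shows "G ** matrix_inv G = mat 1"
proof -
  have "\<exists>H. H ** G = mat 1"
    unfolding matrix_left_invertible_ker using assms unfolding pos_def_def by fastforce
  then have "invertible G" by (simp add: invertible_left_inverse)
  then have "\<exists>H. G ** H = mat 1 \<and> H ** G = mat 1" by (simp add: invertible_def)
  then show ?thesis unfolding matrix_inv_def by (rule someI2_ex) simp
qed

lemma riccati_gain_pos_def:
  fixes R1 R2 :: "real^'l^'l" and B :: "real^'l^'n"
  assumes "pos_def R1" "psd R2" "psd P"
  shows "pos_def (R1 + R2 + transpose B ** P ** B)"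
  unfolding pos_def_def
proof (intro conjI allI impI)
  show "transpose (R1 + R2 + transpose B ** P ** B) = R1 + R2 + transpose B ** P ** B"
  proof -
    have "transpose (X + Y) = transpose X + transpose Y" for X Y :: "real^'l^'l"
      by (simp add: transpose_def vec_eq_iff)
    then show ?thesis
      using assms by (simp add: pos_def_def psd_def matrix_transpose_mul matrix_mul_assoc)
  qed
  fix x :: "real^'l" assume "x \<noteq> 0"
  have "x \<bullet> ((transpose B ** P ** B) *v x) = (B *v x) \<bullet> (P *v (B *v x))"
    using dot_matrix_transpose[of x "transpose B" "P *v (B *v x)"]
    by (simp add: matrix_vector_mul_assoc matrix_mul_assoc)
  moreover have "0 < x \<bullet> (R1 *v x)" "0 \<le> x \<bullet> (R2 *v x)" "0 \<le> (B *v x) \<bullet> (P *v (B *v x))"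
    using assms \<open>x \<noteq> 0\<close> by (auto simp: pos_def_def psd_def)
  ultimately show "0 < x \<bullet> ((R1 + R2 + transpose B ** P ** B) *v x)"
    by (simp add: matrix_vector_mult_add_rdistrib inner_add_right)
qed

text \<open>With \<open>y = P (A + B K) h\<close> the Riccati equation reads \<open>Q h = P h - A\<^sup>T y\<close> and the
  definition of the gain reads \<open>R K h = - B\<^sup>T y\<close>. Pairing these with \<open>x\<close> and \<open>u\<close> gives the
  identity for arbitrary \<open>u\<close>, not just for feedback controls.\<close>

lemma riccati_cross_term:
  fixes A P Q :: "real^'n^'n" and B :: "real^'l^'n" and R :: "real^'l^'l"
  assumes inv: "(R + transpose B ** P ** B) ** Gi = mat 1"
    and ric: "P = transpose A ** P ** A + Q - transpose A ** P ** B ** Gi ** transpose B ** P ** A"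
    and K: "K = - (Gi ** transpose B ** P ** A)"
  shows "x \<bullet> (Q *v h) + u \<bullet> (R *v (K *v h))
    = x \<bullet> (P *v h) - (A *v x + B *v u) \<bullet> (P *v (A *v h + B *v (K *v h)))"
proof -
  let ?y = "P *v (A *v h + B *v (K *v h))"
  have neg: "(- X) *v y = - (X *v y)" for X :: "real^'x^'y" and y
    by (simp add: vec_eq_iff matrix_vector_mult_def sum_negf)
  have Kh: "K *v h = - (Gi *v (transpose B *v (P *v (A *v h))))"
    by (simp add: K neg matrix_vector_mul_assoc matrix_mul_assoc)
  have "(R + transpose B ** P ** B) *v (K *v h)
      = - (((R + transpose B ** P ** B) ** Gi) *v (transpose B *v (P *v (A *v h))))"
    by (simp only: Kh matrix_vector_mul_assoc matrix_mul_assoc linear_neg[OF matrix_vector_mul_linear])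
  then have "R *v (K *v h) + transpose B *v (P *v (B *v (K *v h))) = - (transpose B *v (P *v (A *v h)))"
    by (simp add: inv matrix_vector_mult_add_rdistrib matrix_vector_mul_assoc[symmetric])
  then have "R *v (K *v h) = - (transpose B *v (P *v (A *v h))) - transpose B *v (P *v (B *v (K *v h)))"
    by (simp only: eq_diff_eq)
  then have R: "R *v (K *v h) = - (transpose B *v ?y)"
    by (simp only: matrix_vector_right_distrib minus_add_distrib diff_conv_add_uminus)
  have "P *v h = (transpose A ** P ** A + Q - transpose A ** P ** B ** Gi ** transpose B ** P ** A) *v h"
    using ric by (rule arg_cong)
  also have "\<dots> = transpose A *v (P *v (A *v h)) + Q *v h
      + transpose A *v (P *v (B *v (K *v h)))"
    by (simp only: Kh matrix_vector_mult_add_rdistrib matrix_vector_mult_diff_rdistrib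
        matrix_vector_mul_assoc[symmetric] linear_neg[OF matrix_vector_mul_linear])
      (simp only: diff_conv_add_uminus)
  finally have Q: "Q *v h = P *v h - transpose A *v ?y"
    by (simp add: matrix_vector_right_distrib)
  show ?thesis
    using dot_matrix_transpose[of x "transpose A" ?y] dot_matrix_transpose[of u "transpose B" ?y]
    unfolding R Q by (simp add: inner_diff_right inner_add_left)
qed

section \<open>From a summed bound to a count\<close>

text \<open>A Markov-type inequality for the counting measure.\<close>

lemma count_from_sum_bound:
  fixes a :: "nat \<Rightarrow> real"
  assumes \<alpha>: "\<alpha> \<in> K_inf" and a: "\<And>k. 0 \<le> a k" and T: "(\<Sum>k<N. \<alpha> (a k)) \<le> T" and \<epsilon>: "\<epsilon> > 0"
  shows "real (card {k. k < N \<and> a k \<le> \<epsilon>}) \<ge> real N - T / \<alpha> \<epsilon>"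
proof -
  have mono: "strict_mono_on {0..} \<alpha>" and zero: "\<alpha> 0 = 0" using \<alpha> by (auto simp: K_inf_def)
  have pos: "0 < \<alpha> \<epsilon>" using strict_mono_onD[OF mono, of 0 \<epsilon>] \<epsilon> zero by simp
  have nonneg: "0 \<le> \<alpha> (a k)" for k
    using strict_mono_on_leD[OF mono, of 0 "a k"] a[of k] zero by simp
  let ?good = "{k. k < N \<and> a k \<le> \<epsilon>}" and ?bad = "{k. k < N \<and> \<epsilon> < a k}"
  have "real (card ?bad) * \<alpha> \<epsilon> = (\<Sum>k\<in>?bad. \<alpha> \<epsilon>)" by simp
  also have "\<dots> \<le> (\<Sum>k\<in>?bad. \<alpha> (a k))"
    using strict_mono_on_leD[OF mono, of \<epsilon>] \<epsilon> by (intro sum_mono) auto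
  also have "\<dots> \<le> (\<Sum>k<N. \<alpha> (a k))"
    by (rule sum_mono2) (auto simp: nonneg)
  finally have "real (card ?bad) \<le> T / \<alpha> \<epsilon>"
    using T pos by (simp add: field_simps)
  moreover have "card ?good + card ?bad = N"
  proof -
    have "card (?good \<union> ?bad) = card ?good + card ?bad"
      by (rule card_Un_disjoint) auto
    moreover have "?good \<union> ?bad = {..<N}" by auto
    ultimately show ?thesis by simp
  qed
  ultimately show ?thesis by linarith
qed

section \<open>The turnpike estimate\<close>

theorem theorem4p2:
  fixes M :: "'w measure"
    and A :: "real^'n^'n" and B :: "real^'l^'n" and E :: "real^'m^'n" and z :: "real^'n"
    and W :: "nat \<Rightarrow> 'w \<Rightarrow> real^'m" and rhoW :: "(real^'m) measure"
    and muW :: "real^'m" and SigmaW :: "real^'m^'m"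
    and Q1 Q2 :: "real^'n^'n" and R1 R2 :: "real^'l^'l"
    and r :: "real^'n" and v :: "real^'l" and c :: real
    and xs :: "real^'n" and us :: "real^'l"
    and P :: "real^'n^'n" and K :: "real^'n^'l"
    and rhat :: "real^'n" and vhat :: "real^'l" and chat :: real
    and Xhat :: "nat \<Rightarrow> 'w \<Rightarrow> real^'n" and Uhat :: "nat \<Rightarrow> 'w \<Rightarrow> real^'l"
    and rhohat :: "(real^'n) measure"
    and xt :: "real^'n" and ut :: "real^'l"
    and \<alpha> :: "real \<Rightarrow> real" and S :: "real^'n^'n" and q :: "real^'n"
    and Xstar :: "nat \<Rightarrow> 'w \<Rightarrow> real^'n" and Ustar :: "nat \<Rightarrow> 'w \<Rightarrow> real^'l"
  assumes prob: "prob_space M"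
    and stab: "stabilizable A B"
    and W_L2: "\<And>k. W k \<in> L2 M M"
    and W_indep: "prob_space.indep_vars M (\<lambda>_. borel) W UNIV"
    and W_law: "\<And>k. distr M borel (W k) = rhoW"
    and W_mean: "muW = integral\<^sup>L rhoW (\<lambda>w. w)"
    and W_cov: "SigmaW = cov_mat rhoW (\<lambda>w. w)"
    and weights: "psd Q1" "psd Q2" "pos_def R1" "psd R2"
    and steady: "(mat 1 - A) *v xs - B *v us = E *v muW + z"
    and detect: "detectable A (psd_sqrt Q1)"
    and P_psd: "psd P"
    and riccati: "P = transpose A ** P ** A + (Q1 + Q2)
        - transpose A ** P ** B ** matrix_inv ((R1 + R2) + transpose B ** P ** B)
            ** transpose B ** P ** A"
    and K: "K = - (matrix_inv ((R1 + R2) + transpose B ** P ** B) ** transpose B ** P ** A)"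
    and rhat: "rhat = r + 2 *\<^sub>R (Q1 *v xs)"
    and vhat: "vhat = v + 2 *\<^sub>R (R1 *v us)"
    and chat: "chat = xs \<bullet> (Q1 *v xs) + us \<bullet> (R1 *v us) + r \<bullet> xs + v \<bullet> us + c"
    and Xhat_step: "\<And>k. Xhat (Suc k) =
        (\<lambda>\<omega>. A *v Xhat k \<omega> + B *v Uhat k \<omega> + E *v (W k \<omega> - muW))"
    and Uhat: "\<And>k. Uhat k = (\<lambda>\<omega>. K *v Xhat k \<omega>)"
    and hat_adm: "admissible M W Xhat Uhat"
    and hat_law: "\<And>k. distr M borel (Xhat k) = rhohat"
    and rhohat: "rhohat \<in> P2" "integral\<^sup>L rhohat (\<lambda>x. x) = 0"
    and tilde_steady: "(mat 1 - A) *v xt - B *v ut = 0"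
    and alpha: "\<alpha> \<in> K_inf"
    and S: "pos_def S"
    and dissipation: "\<And>X0 U X k Xtilde Utilde.
        X0 \<in> L2 M M \<Longrightarrow> X = solution A B E z W U X0 \<Longrightarrow> admissible M W X U \<Longrightarrow>
        Xtilde = (\<lambda>\<omega>. X k \<omega> - xs - Xhat k \<omega>) \<Longrightarrow>
        Utilde = (\<lambda>\<omega>. U k \<omega> - us - Uhat k \<omega>) \<Longrightarrow>
        stage_cost M Q1 Q2 R1 R2 rhat vhat chat Xtilde Utilde
          - stage_cost M Q1 Q2 R1 R2 rhat vhat chat (\<lambda>_. xt) (\<lambda>_. ut)
          + storage M S q Xtilde - storage M S q (\<lambda>\<omega>. A *v Xtilde \<omega> + B *v Utilde \<omega>)
        \<ge> \<alpha> (integral\<^sup>L M (\<lambda>\<omega>. (norm (Xtilde \<omega> - xt))\<^sup>2))"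
    and Xstar_0: "Xstar 0 = (\<lambda>\<omega>. Xhat 0 \<omega> + xs + xt)"
    and Xstar_step: "\<And>k. Xstar (Suc k) = (\<lambda>\<omega>. sys_f A B E z (Xstar k \<omega>) (Ustar k \<omega>) (W k \<omega>))"
    and Ustar: "\<And>k. Ustar k = (\<lambda>\<omega>. K *v (Xstar k \<omega> - xt - xs) + ut + us)"
  shows "\<forall>X0 \<in> L2 M M. \<exists>C::real. \<forall>N\<ge>1. \<forall>\<delta>>0. \<forall>U.
      admissible M W (solution A B E z W U X0) U \<longrightarrow>
      total_cost M A B E z W Q1 Q2 R1 R2 r v c N X0 U
        \<le> \<delta> + (\<Sum>k<N. stage_cost M Q1 Q2 R1 R2 r v c (Xstar k) (Ustar k)) \<longrightarrow>
      (\<forall>\<epsilon>>0.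
        real (card {k. k < N \<and>
            integral\<^sup>L M (\<lambda>\<omega>. (norm (solution A B E z W U X0 k \<omega> - Xstar k \<omega>))\<^sup>2) \<le> \<epsilon>})
          \<ge> real N - (\<delta> + C) / \<alpha> \<epsilon>)"
proof -
  interpret prob_space M by (rule prob)
  define Q where "Q = Q1 + Q2"
  define R where "R = R1 + R2"
  have sym: "transpose Q1 = Q1" "transpose Q2 = Q2" "transpose R1 = R1" "transpose R2 = R2"
    using weights by (auto simp: psd_def pos_def_def)
  have riccati_id: "x \<bullet> (Q *v h) + u \<bullet> (R *v (K *v h))
      = x \<bullet> (P *v h) - (A *v x + B *v u) \<bullet> (P *v (A *v h + B *v (K *v h)))" for x h u
    using riccati_cross_term[OF pos_def_matrix_inv[OF riccati_gain_pos_def]] weights P_psd riccati K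
    unfolding Q_def R_def by blast
  obtain \<sigma> where \<sigma>: "\<sigma> > 0" "\<And>x. \<sigma> * (norm x)\<^sup>2 \<le> x \<bullet> (S *v x)"
    using pos_def_coercive[OF S] by blast

  have EW: "expectation (W k) = muW" for k
    using integral_distr[of "W k" M borel "\<lambda>w. w"] L2_D(1)[OF W_L2[of k]] W_law[of k] W_mean by simp
  have Xh: "Xhat k \<in> L2 M M" and Uh: "Uhat k \<in> L2 M M"
    and ind_hat: "indep_rv M (W k) (Xhat k)" "indep_rv M (W k) (Uhat k)" for k
    using hat_adm L2_top unfolding admissible_def by blast+
  have EXh: "expectation (Xhat k) = 0" for k
    using integral_distr[of "Xhat k" M borel "\<lambda>x. x"] L2_D(1)[OF Xh[of k]] hat_law[of k] rhohat(2) by simp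
  have EUh: "expectation (Uhat k) = 0" for k
    using expectation_matrix[OF L2_integrable[OF Xh]] EXh by (simp add: Uhat)

  define base where "base k = expectation (\<lambda>\<omega>. Xhat k \<omega> \<bullet> (Q *v Xhat k \<omega>))
      + expectation (\<lambda>\<omega>. Uhat k \<omega> \<bullet> (R *v Uhat k \<omega>))" for k
  define lhat where "lhat = stage_cost M Q1 Q2 R1 R2 rhat vhat chat"
  have split: "stage_cost M Q1 Q2 R1 R2 r v c (\<lambda>\<omega>. Y \<omega> + xs + Xhat k \<omega>) (\<lambda>\<omega>. V \<omega> + us + Uhat k \<omega>)
      = lhat Y V + base k + 2 * (expectation (\<lambda>\<omega>. Y \<omega> \<bullet> (Q *v Xhat k \<omega>))
        + expectation (\<lambda>\<omega>. V \<omega> \<bullet> (R *v Uhat k \<omega>)))"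
    if "Y \<in> L2 M M" "V \<in> L2 M M" for Y V k
    unfolding lhat_def base_def Q_def R_def rhat vhat chat
    by (rule stage_cost_decompose[OF that(1) Xh that(2) Uh EXh EUh sym])

  have Xstar: "Xstar k = (\<lambda>\<omega>. xt + xs + Xhat k \<omega>)" for k
  proof (induction k)
    case 0
    show ?case by (simp add: Xstar_0 add_ac)
  next
    case (Suc k)
    have "E *v muW = xs - A *v xs - B *v us - z" "B *v ut = xt - A *v xt"
      using steady tilde_steady by (auto simp: matrix_vector_mult_diff_rdistrib algebra_simps)
    then show ?case
      by (auto simp: Xstar_step Xhat_step Ustar Uhat Suc sys_f_def matrix_vector_right_distrib
          matrix_vector_mult_diff_distrib fun_eq_iff)
  qed
  have Ustar': "Ustar k = (\<lambda>\<omega>. ut + us + Uhat k \<omega>)" for k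
    by (simp add: Ustar Xstar Uhat add_ac)
  have star_cost: "stage_cost M Q1 Q2 R1 R2 r v c (Xstar k) (Ustar k) = lhat (\<lambda>_. xt) (\<lambda>_. ut) + base k" for k
    using expectation_matrix[OF L2_integrable[OF Xh], of Q k] expectation_matrix[OF L2_integrable[OF Uh], of R k]
      L2_integrable[OF L2_matrix[OF Xh], of Q k] L2_integrable[OF L2_matrix[OF Uh], of R k]
    by (simp add: Xstar Ustar' split L2_const EXh EUh)

  show ?thesis
  proof (rule ballI)
    fix X0 :: "'w \<Rightarrow> real^'n" assume X0: "X0 \<in> L2 M M"
    define Y0 where "Y0 = (\<lambda>\<omega>. X0 \<omega> - xs - Xhat 0 \<omega>)"
    \<comment> \<open>\<open>D\<close> bounds \<open>2 Z(N) - \<lambda>(Y(N))\<close> for every \<open>N\<close>, since \<open>Xhat\<close> is stationary; the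
      rest of \<open>C\<close> is \<open>\<Phi>(0)\<close>.\<close>
    define D where "D = (\<integral>x. (norm (q - (2 *\<^sub>R P) *v x))\<^sup>2 / (4 * \<sigma>) \<partial>rhohat)"
    define C where "C = D + storage M S q Y0 - 2 * expectation (\<lambda>\<omega>. Y0 \<omega> \<bullet> (P *v Xhat 0 \<omega>))"
    have D: "expectation (\<lambda>\<omega>. (norm (q - (2 *\<^sub>R P) *v Xhat k \<omega>))\<^sup>2 / (4 * \<sigma>)) = D" for k
    proof -
      have "(\<lambda>x. (norm (q - (2 *\<^sub>R P) *v x))\<^sup>2 / (4 * \<sigma>)) \<in> borel_measurable borel"
        by (intro borel_measurable_continuous_onI continuous_intros linear_continuous_on) (use \<sigma> in auto)
      then show ?thesis
        unfolding D_def hat_law[of k, symmetric] using L2_D(1)[OF Xh] by (subst integral_distr) auto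
    qed
    show "\<exists>C::real. \<forall>N\<ge>1. \<forall>\<delta>>0. \<forall>U.
      admissible M W (solution A B E z W U X0) U \<longrightarrow>
      total_cost M A B E z W Q1 Q2 R1 R2 r v c N X0 U
        \<le> \<delta> + (\<Sum>k<N. stage_cost M Q1 Q2 R1 R2 r v c (Xstar k) (Ustar k)) \<longrightarrow>
      (\<forall>\<epsilon>>0.
        real (card {k. k < N \<and>
            integral\<^sup>L M (\<lambda>\<omega>. (norm (solution A B E z W U X0 k \<omega> - Xstar k \<omega>))\<^sup>2) \<le> \<epsilon>})
          \<ge> real N - (\<delta> + C) / \<alpha> \<epsilon>)"
    proof (intro exI[of _ C] allI impI)
      fix N :: nat and \<delta> :: real and U :: "nat \<Rightarrow> 'w \<Rightarrow> real^'l" and \<epsilon> :: real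
      assume adm: "admissible M W (solution A B E z W U X0) U"
        and near_opt: "total_cost M A B E z W Q1 Q2 R1 R2 r v c N X0 U
          \<le> \<delta> + (\<Sum>k<N. stage_cost M Q1 Q2 R1 R2 r v c (Xstar k) (Ustar k))"
        and \<epsilon>: "\<epsilon> > 0"
      define X where "X = solution A B E z W U X0"
      define Y where "Y k = (\<lambda>\<omega>. X k \<omega> - xs - Xhat k \<omega>)" for k
      define V where "V k = (\<lambda>\<omega>. U k \<omega> - us - Uhat k \<omega>)" for k
      define Z where "Z k = expectation (\<lambda>\<omega>. Y k \<omega> \<bullet> (P *v Xhat k \<omega>))" for k
      define \<Phi> where "\<Phi> k = storage M S q (Y k) - 2 * Z k" for k
      define a where "a k = expectation (\<lambda>\<omega>. (norm (Y k \<omega> - xt))\<^sup>2)" for k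
      have XL: "X k \<in> L2 M M" and UL: "U k \<in> L2 M M"
        and ind: "indep_rv M (W k) (X k)" "indep_rv M (W k) (U k)" for k
        using adm L2_top unfolding admissible_def X_def by blast+
      have YL: "Y k \<in> L2 M M" and VL: "V k \<in> L2 M M" for k
        unfolding Y_def V_def by (intro L2_diff XL UL Xh Uh L2_const)+
      have Y_step: "Y (Suc k) = (\<lambda>\<omega>. A *v Y k \<omega> + B *v V k \<omega>)" for k
      proof -
        have "E *v muW = xs - A *v xs - B *v us - z"
          using steady by (simp add: matrix_vector_mult_diff_rdistrib algebra_simps)
        then show ?thesis
          by (auto simp: Y_def V_def X_def Xhat_step sys_f_def matrix_vector_right_distrib
              matrix_vector_mult_diff_distrib fun_eq_iff)
      qed

      have cross: "expectation (\<lambda>\<omega>. Y k \<omega> \<bullet> (Q *v Xhat k \<omega>)) + expectation (\<lambda>\<omega>. V k \<omega> \<bullet> (R *v Uhat k \<omega>))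
          = Z k - Z (Suc k)" for k
      proof -
        let ?H = "\<lambda>\<omega>. A *v Xhat k \<omega> + B *v Uhat k \<omega>"
        let ?w = "\<lambda>\<omega>. (P ** E) *v (W k \<omega> - muW)"
        have i: "integrable M (\<lambda>\<omega>. Y k \<omega> \<bullet> (Q *v Xhat k \<omega>))" "integrable M (\<lambda>\<omega>. V k \<omega> \<bullet> (R *v Uhat k \<omega>))"
          "integrable M (\<lambda>\<omega>. Y k \<omega> \<bullet> (P *v Xhat k \<omega>))"
          "integrable M (\<lambda>\<omega>. Y (Suc k) \<omega> \<bullet> (P *v ?H \<omega>))" "integrable M (\<lambda>\<omega>. Y (Suc k) \<omega> \<bullet> ?w \<omega>)"
          by (intro L2_inner_integrable L2_matrix YL VL Xh Uh L2_add L2_diff W_L2 L2_const)+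
        have "expectation (\<lambda>\<omega>. (A *v Y k \<omega> + B *v V k \<omega>) \<bullet> ?w \<omega>) = 0"
          unfolding Y_def V_def EW[of k, symmetric]
          by (rule expectation_inner_next_noise[OF W_L2 XL Xh UL Uh ind(1) ind_hat(1) ind(2) ind_hat(2)])
        then have "expectation (\<lambda>\<omega>. Y (Suc k) \<omega> \<bullet> ?w \<omega>) = 0"
          by (simp only: Y_step)
        moreover have "Y (Suc k) \<omega> \<bullet> (P *v Xhat (Suc k) \<omega>) = Y (Suc k) \<omega> \<bullet> (P *v ?H \<omega>) + Y (Suc k) \<omega> \<bullet> ?w \<omega>" for \<omega>
          by (simp add: Xhat_step matrix_vector_right_distrib[of P "_ + _"] inner_add_right
              matrix_vector_mul_assoc[symmetric])
        ultimately have succ: "Z (Suc k) = expectation (\<lambda>\<omega>. Y (Suc k) \<omega> \<bullet> (P *v ?H \<omega>))"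
          unfolding Z_def using i by simp
        have "expectation (\<lambda>\<omega>. Y k \<omega> \<bullet> (Q *v Xhat k \<omega>)) + expectation (\<lambda>\<omega>. V k \<omega> \<bullet> (R *v Uhat k \<omega>))
            = expectation (\<lambda>\<omega>. Y k \<omega> \<bullet> (Q *v Xhat k \<omega>) + V k \<omega> \<bullet> (R *v Uhat k \<omega>))"
          using i by simp
        also have "\<dots> = expectation (\<lambda>\<omega>. Y k \<omega> \<bullet> (P *v Xhat k \<omega>) - Y (Suc k) \<omega> \<bullet> (P *v ?H \<omega>))"
          using riccati_id by (simp add: Uhat Y_step)
        also have "\<dots> = Z k - Z (Suc k)"
          unfolding succ unfolding Z_def using i by simp
        finally show ?thesis .
      qed
      have cost: "stage_cost M Q1 Q2 R1 R2 r v c (X k) (U k) = lhat (Y k) (V k) + base k + 2 * (Z k - Z (Suc k))" for k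
      proof -
        have "X k = (\<lambda>\<omega>. Y k \<omega> + xs + Xhat k \<omega>)" "U k = (\<lambda>\<omega>. V k \<omega> + us + Uhat k \<omega>)"
          by (simp_all add: Y_def V_def)
        then show ?thesis
          using split[OF YL VL, of k k k] cross[of k] by simp
      qed
      have step: "\<alpha> (a k) \<le> (stage_cost M Q1 Q2 R1 R2 r v c (X k) (U k)
            - stage_cost M Q1 Q2 R1 R2 r v c (Xstar k) (Ustar k))
          + (\<Phi> k - \<Phi> (Suc k))" for k
        using dissipation[OF X0 X_def _ Y_def V_def, of k] adm cost[of k] star_cost[of k]
        unfolding a_def lhat_def \<Phi>_def Y_step[of k] X_def by simp
      have "(\<Sum>k<N. \<alpha> (a k)) \<le> (\<Sum>k<N. (stage_cost M Q1 Q2 R1 R2 r v c (X k) (U k)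
            - stage_cost M Q1 Q2 R1 R2 r v c (Xstar k) (Ustar k))
          + (\<Phi> k - \<Phi> (Suc k)))"
        by (rule sum_mono) (rule step)
      also have "\<dots> = total_cost M A B E z W Q1 Q2 R1 R2 r v c N X0 U
            - (\<Sum>k<N. stage_cost M Q1 Q2 R1 R2 r v c (Xstar k) (Ustar k))
          + (\<Phi> 0 - \<Phi> N)"
        unfolding sum.distrib sum_lessThan_telescope' unfolding sum_subtractf total_cost_def X_def by simp
      also have "\<dots> \<le> \<delta> + C"
      proof -
        have "- \<Phi> N \<le> D"
          using storage_dominates_linear[OF YL[of N] Xh[of N] \<sigma>, of P q] D[of N] unfolding \<Phi>_def Z_def by simp
        moreover have "Y 0 = Y0" by (simp add: Y_def Y0_def X_def)
        ultimately show ?thesis using near_opt by (simp add: C_def \<Phi>_def Z_def)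
      qed
      finally have "real (card {k. k < N \<and> a k \<le> \<epsilon>}) \<ge> real N - (\<delta> + C) / \<alpha> \<epsilon>"
        by (intro count_from_sum_bound[OF alpha _ _ \<epsilon>]) (auto simp: a_def)
      moreover have "Y k \<omega> - xt = X k \<omega> - Xstar k \<omega>" for k \<omega>
        by (simp add: Y_def Xstar)
      ultimately show "real (card {k. k < N \<and>
            integral\<^sup>L M (\<lambda>\<omega>. (norm (solution A B E z W U X0 k \<omega> - Xstar k \<omega>))\<^sup>2) \<le> \<epsilon>})
          \<ge> real N - (\<delta> + C) / \<alpha> \<epsilon>"
        unfolding a_def X_def by simp
    qed
  qed
qed

end
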